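(* Suppose that $(A_{\text{true}},B_{\text{true}})\in\Sigma_{\text{stab}}$ and $\operatorname{rank}X_-=n$. Then the following statements are equivalent: (a) The data $\mathcal{D}$ are $\Sigma_{\text{stab}}$-informative for stabilization. (b) The data $\mathcal{D}$ are informative for stabilization.
   Context: Let $n,m,T$ be positive integers and $\mathcal{M}=\mathbb{R}^{n\times n}\times\mathbb{R}^{n\times m}$. Let $(A_{\text{true}},B_{\text{true}})\in\mathcal{M}$ be the (unknown) true system. The data $\mathcal{D}$ consist of inputs $u(0),\dots,u(T-1)\in\mathbb{R}^m$ and states $x(0),\dots,x(T)\in\mathbb{R}^n$ satisfying $x(t+1)=A_{\text{true}}x(t)+B_{\text{true}}u(t)$ for $t=0,\dots,T-1$. Set $U_-=\begin{bmatrix}u(0)&\cdots&u(T-1)\end{bmatrix}$, $X_-=\begin{bmatrix}x(0)&\cdots&x(T-1)\end{bmatrix}$, $X_+=\begin{bmatrix}x(1)&\cdots&x(T)\end{bmatrix}$. The set of data-consistent systems is $\Sigma_{\mathcal{D}}=\{(A,B)\in\mathcal{M}\mid X_+=AX_-+BU_-\}$. A real square matrix is Schur if all its eigenvalues have modulus strictly less than $1$. The set $\Sigma_{\text{stab}}$ is the set of all stabilizable pairs $(A,B)\in\mathcal{M}$, i.e. those for which there is $K\in\mathbb{R}^{m\times n}$ with $A+BK$ Schur. For $\Sigma_{\text{pk}}\subseteq\mathcal{M}$, the data $\mathcal{D}$ are called $\Sigma_{\text{pk}}$-informative for stabilization if there exists a single $K\in\mathbb{R}^{m\times n}$ such that $A+BK$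 is Schur for all $(A,B)\in\Sigma_{\mathcal{D}}\cap\Sigma_{\text{pk}}$; they are called informative for stabilization if this holds with $\Sigma_{\text{pk}}=\mathcal{M}$. *)

theory Defs
  imports Complex_Main "Jordan_Normal_Form.Char_Poly" "Jordan_Normal_Form.DL_Rank"
begin

definition system_space :: "nat \<Rightarrow> nat \<Rightarrow> (real mat \<times> real mat) set" where
  "system_space n m = carrier_mat n n \<times> carrier_mat n m"

text \<open>The eigenvalues of a real matrix are its complex eigenvalues, hence the coercion.\<close>

definition schur :: "real mat \<Rightarrow> bool" where
  "schur A \<longleftrightarrow> square_mat A \<and>
     (\<forall>k. eigenvalue (map_mat complex_of_real A) k \<longrightarrow> cmod k < 1)"

definition stabilizable_systems :: "nat \<Rightarrow> nat \<Rightarrow> (real mat \<times> real mat) set" where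
  "stabilizable_systems n m =
     {(A, B) \<in> system_space n m. \<exists>K \<in> carrier_mat m n. schur (A + B * K)}"

text \<open>
  A data set of length \<open>T\<close> is given by sequences \<open>u\<close> and \<open>x\<close>, of which only
  \<open>u 0, \<dots>, u (T - 1)\<close> and \<open>x 0, \<dots>, x T\<close> are used.
\<close>

definition input_state_data ::
  "nat \<Rightarrow> nat \<Rightarrow> nat \<Rightarrow> real mat \<Rightarrow> real mat \<Rightarrow> (nat \<Rightarrow> real vec) \<Rightarrow> (nat \<Rightarrow> real vec) \<Rightarrow> bool" where
  "input_state_data n m T A B u x \<longleftrightarrow>
     (\<forall>t<T. u t \<in> carrier_vec m) \<and> (\<forall>t\<le>T. x t \<in> carrier_vec n) \<and>
     (\<forall>t<T. x (t + 1) = A *\<^sub>v x t + B *\<^sub>v u t)"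

definition U_minus :: "nat \<Rightarrow> nat \<Rightarrow> (nat \<Rightarrow> real vec) \<Rightarrow> real mat" where
  "U_minus m T u = mat_of_cols m (map u [0..<T])"

definition X_minus :: "nat \<Rightarrow> nat \<Rightarrow> (nat \<Rightarrow> real vec) \<Rightarrow> real mat" where
  "X_minus n T x = mat_of_cols n (map x [0..<T])"

definition X_plus :: "nat \<Rightarrow> nat \<Rightarrow> (nat \<Rightarrow> real vec) \<Rightarrow> real mat" where
  "X_plus n T x = mat_of_cols n (map x [1..<T + 1])"

definition consistent_systems ::
  "nat \<Rightarrow> nat \<Rightarrow> nat \<Rightarrow> (nat \<Rightarrow> real vec) \<Rightarrow> (nat \<Rightarrow> real vec) \<Rightarrow> (real mat \<times> real mat) set" where
  "consistent_systems n m T u x =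
     {(A, B) \<in> system_space n m. X_plus n T x = A * X_minus n T x + B * U_minus m T u}"

definition informative_for_stabilization_wrt ::
  "(real mat \<times> real mat) set \<Rightarrow> nat \<Rightarrow> nat \<Rightarrow> nat \<Rightarrow> (nat \<Rightarrow> real vec) \<Rightarrow> (nat \<Rightarrow> real vec) \<Rightarrow> bool" where
  "informative_for_stabilization_wrt S n m T u x \<longleftrightarrow>
     (\<exists>K \<in> carrier_mat m n. \<forall>(A, B) \<in> consistent_systems n m T u x \<inter> S. schur (A + B * K))"

definition informative_for_stabilization ::
  "nat \<Rightarrow> nat \<Rightarrow> nat \<Rightarrow> (nat \<Rightarrow> real vec) \<Rightarrow> (nat \<Rightarrow> real vec) \<Rightarrow> bool" where
  "informative_for_stabilization n m T u x \<longleftrightarrow>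
     informative_for_stabilization_wrt (system_space n m) n m T u x"

end

(*
  The gain K for the stabilizable systems works for all consistent systems: it gives all of them the
  closed loop M = A + B K of the true system (A, B). Otherwise some consistent (A', B') has a row
  index i such that the rows a of A' - A and l of B' - B satisfy w = a + K^T l \<noteq> 0, and l \<noteq> 0
  because X_minus has full row rank. For every v the system (A + v a^T, B + v l^T) is consistent, with
  closed loop M + v w^T under K. Put b = B l / |l|^2 and use gains K - c l w^T. For v = s b with
  s \<noteq> -1 a suitable c recovers the Schur matrix M, so the system is stabilizable and M + s b w^T is
  Schur; hence M - b w^T is Schur as well. With c = 1 / |l|^2 the closed loop is M - b w^T whatever v
  is, so the system is stabilizable and M + v w^T is Schur for all v, although v can be chosen to give
  it the eigenvalue 1.
*)
theory Submission
  imports Defs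
begin

section \<open>Rank-one matrices\<close>

definition outer :: "'a :: times vec \<Rightarrow> 'a vec \<Rightarrow> 'a mat" where
  "outer v w = mat (dim_vec v) (dim_vec w) (\<lambda>(i, j). v $ i * w $ j)"

lemma outer_carrier [simp, intro]:
  "v \<in> carrier_vec n \<Longrightarrow> w \<in> carrier_vec m \<Longrightarrow> outer v w \<in> carrier_mat n m"
  by (simp add: outer_def)

lemma dim_outer [simp]: "dim_row (outer v w) = dim_vec v" "dim_col (outer v w) = dim_vec w"
  by (simp_all add: outer_def)

lemma index_outer [simp]: "i < dim_vec v \<Longrightarrow> j < dim_vec w \<Longrightarrow> outer v w $$ (i, j) = v $ i * w $ j"
  by (simp add: outer_def)

lemma row_outer: "i < dim_vec v \<Longrightarrow> row (outer v w) i = v $ i \<cdot>\<^sub>v w"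
  by (intro eq_vecI) auto

lemma col_outer: "j < dim_vec w \<Longrightarrow> col (outer v w) j = w $ j \<cdot>\<^sub>v (v :: 'a :: comm_semiring_0 vec)"
  by (intro eq_vecI) (auto simp: mult.commute)

lemma mult_outer:
  fixes A :: "'a :: comm_semiring_0 mat"
  assumes "A \<in> carrier_mat r n" "v \<in> carrier_vec n"
  shows "A * outer v w = outer (A *\<^sub>v v) w"
  using assms by (intro eq_matI) (auto simp: col_outer mult.commute)

lemma outer_mult:
  fixes A :: "'a :: comm_semiring_0 mat"
  assumes "A \<in> carrier_mat n r" "w \<in> carrier_vec n"
  shows "outer v w * A = outer v (A\<^sup>T *\<^sub>v w)"
  using assms by (intro eq_matI) (auto simp: row_outer comm_scalar_prod[of w n])

lemma outer_mult_vec: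
  fixes v :: "'a :: comm_semiring_0 vec"
  assumes "v \<in> carrier_vec n" "w \<in> carrier_vec m" "y \<in> carrier_vec m"
  shows "outer v w *\<^sub>v y = (w \<bullet> y) \<cdot>\<^sub>v v"
  using assms by (intro eq_vecI) (auto simp: row_outer mult.commute)

text \<open>By the rank assumption a maximal independent set of columns has \<open>n\<close>
  elements and is a basis. So \<open>a\<close> lies in the span of columns to which it is
  orthogonal, hence is orthogonal to itself.\<close>

lemma row_scalar_prods_zero_imp_zero:
  fixes X :: "real mat"
  assumes X: "X \<in> carrier_mat n T" and rank: "vec_space.rank n X = n"
    and a: "a \<in> carrier_vec n" and orth: "\<And>t. t < T \<Longrightarrow> a \<bullet> col X t = 0"
  shows "a = 0\<^sub>v n"
proof -
  interpret vec_space "TYPE(real)" n .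
  have cols: "set (cols X) \<subseteq> carrier_vec n"
    using X cols_dim by blast
  obtain S where S: "maximal S (\<lambda>T. T \<subseteq> set (cols X) \<and> lin_indpt T)"
    using maximal_exists_superset[of "set (cols X)" "\<lambda>T. T \<subseteq> set (cols X) \<and> lin_indpt T" "{}"]
      finite_lin_indpt2[of "{}"] by auto
  then have sub: "S \<subseteq> set (cols X)" and indpt: "lin_indpt S"
    by (auto simp: maximal_def)
  have "card S = n"
    using rank_card_indpt[OF X S] rank by simp
  then have "basis S"
    using sub indpt cols by (intro dim_li_is_basis) (auto simp: dim_is_n intro: finite_subset)
  then have "a \<in> span S"
    using a by (auto simp: basis_def)
  moreover have "a \<in> orthogonal_complement S"
    using a orth sub X by (auto simp: orthogonal_complement_def cols_def)
  ultimately have "a \<bullet> a = 0"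
    using in_orthogonal_complement_span[of S] sub cols by (auto simp: orthogonal_complement_def)
  then show ?thesis
    using a conjugate_square_eq_0_vec[of a n] by simp
qed

section \<open>Closedness of the Schur property along matrix pencils\<close>

lemma norm_char_poly_le:
  fixes N :: "complex mat"
  assumes N: "N \<in> carrier_mat n n" and bound: "\<And>k. eigenvalue N k \<Longrightarrow> norm k \<le> r"
  shows "norm (poly (char_poly N) z) \<le> (norm z + r) ^ n"
proof -
  \<comment> \<open>Over the complex numbers the characteristic polynomial splits; each linear
    factor at \<open>z\<close> has norm at most \<open>norm z + r\<close>.\<close>
  obtain as where as: "char_poly N = (\<Prod>a\<leftarrow>as. [:- a, 1:])" "length as = n"
    using char_poly_factorized[OF N] by blast
  have "norm a \<le> r" if "a \<in> set as" for a
    using that bound linear_poly_root[of a as] unfolding eigenvalue_root_char_poly[OF N] as(1)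
    by simp
  then have "norm (poly (\<Prod>a\<leftarrow>as. [:- a, 1:]) z) \<le> (norm z + r) ^ length as"
  proof (induction as)
    case (Cons a as)
    have "norm (z - a) \<le> norm z + r"
      using Cons.prems[of a] norm_triangle_ineq4[of z a] by simp
    moreover have "norm (poly (\<Prod>a\<leftarrow>as. [:- a, 1:]) z) \<le> (norm z + r) ^ length as"
      using Cons by simp
    ultimately have "norm (z - a) * norm (poly (\<Prod>a\<leftarrow>as. [:- a, 1:]) z)
        \<le> (norm z + r) * (norm z + r) ^ length as"
      by (intro mult_mono) (auto intro: order_trans[OF norm_ge_zero])
    then show ?case
      by (simp add: norm_mult[symmetric] algebra_simps)
  qed simp
  then show ?thesis
    using as by simp
qed

text \<open>A nonconstant complex polynomial is unbounded along the real axis, and leaving out the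
  single point \<open>c\<close> does not change this.\<close>

lemma poly_eq_if_bounded_on_reals:
  fixes p :: "complex poly"
  assumes "\<And>s :: real. s \<noteq> c \<Longrightarrow> norm (poly p (of_real s)) \<le> C"
  shows "poly p z = poly p z'"
proof -
  obtain a q where p: "p = pCons a q"
    by (cases p)
  have "q = 0"
  proof (rule ccontr)
    assume "q \<noteq> 0"
    from poly_infinity[OF this, of "C + 1" a] obtain r
      where r: "\<And>z. r \<le> norm z \<Longrightarrow> C + 1 \<le> norm (poly (pCons a q) z)" by blast
    \<comment> \<open>A real point beyond both \<open>r\<close>, where the polynomial exceeds
      \<open>C\<close>, and the excluded \<open>c\<close>.\<close>
    define s where "s = \<bar>r\<bar> + \<bar>c\<bar> + 1"
    have "s \<noteq> c" "r \<le> norm (complex_of_real s)"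
      unfolding norm_of_real by (auto simp: s_def)
    then show False
      using r[of "of_real s"] assms[of s] p by simp
  qed
  then show ?thesis
    using p by simp
qed

text \<open>
  The determinant of \<open>\<lambda> I - M - s R\<close> is a polynomial in \<open>s\<close>; if all but one of these matrices are
  Schur it is bounded, hence constant.
\<close>
lemma schur_pencil_closed:
  assumes M: "M \<in> carrier_mat n n" and R: "R \<in> carrier_mat n n"
    and schur: "\<And>s :: real. s \<noteq> c \<Longrightarrow> schur (M + s \<cdot>\<^sub>m R)"
  shows "schur (M + c \<cdot>\<^sub>m R)"
proof -
  let ?N = "\<lambda>s. map_mat complex_of_real (M + s \<cdot>\<^sub>m R)"
  have N: "?N s \<in> carrier_mat n n" for s
    using M R by simp
  have "cmod z < 1" if ev: "eigenvalue (?N c) z" for z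
  proof (rule ccontr)
    assume z: "\<not> cmod z < 1"
    \<comment> \<open>Here \<open>z\<close> is fixed and the indeterminate is the pencil parameter:
      the entries are those of z I - M - s R, as linear polynomials in s.\<close>
    define p where "p = det (mat n n (\<lambda>(i, j).
      [: (if i = j then z else 0) - of_real (M $$ (i, j)), - of_real (R $$ (i, j)) :]))"
    have p: "poly p (of_real s) = poly (char_poly (?N s)) z" for s
      unfolding p_def char_poly_matrix[OF N]
      by (rule poly_det_cong[of _ n]) (use M R in \<open>auto simp: char_matrix_def\<close>)
    have "norm (poly p (of_real s)) \<le> (cmod z + 1) ^ n" if "s \<noteq> c" for s
      unfolding p
      by (rule norm_char_poly_le[OF N]) (use schur[OF that] in \<open>auto simp: schur_def less_imp_le\<close>)
    from poly_eq_if_bounded_on_reals[OF this]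
    have "poly p (of_real (c + 1)) = poly p (of_real c)" .
    also have "\<dots> = 0"
      using ev unfolding p eigenvalue_root_char_poly[OF N] .
    \<comment> \<open>Constancy of \<open>p\<close> carries the root at \<open>c\<close> over to a
      parameter where the matrix is Schur by assumption.\<close>
    finally have "eigenvalue (?N (c + 1)) z"
      unfolding p eigenvalue_root_char_poly[OF N] .
    then show False
      using z schur[of "c + 1"] by (auto simp: schur_def)
  qed
  then show ?thesis
    using M R by (auto simp: schur_def)
qed

lemma not_schur_if_fixed_vec:
  assumes "M \<in> carrier_mat n n" "y \<in> carrier_vec n" "y \<noteq> 0\<^sub>v n" "M *\<^sub>v y = y"
  shows "\<not> schur M"
proof -
  have "eigenvector M y 1"
    using assms by (simp add: eigenvector_def)
  then have "eigenvalue (map_mat complex_of_real M) 1"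
    using of_real_hom.eigenvector_hom[OF assms(1), of y 1]
    unfolding eigenvalue_def by (metis of_real_1)
  then show ?thesis
    by (auto simp: schur_def)
qed

section \<open>Rank-one perturbations of the closed loop\<close>

text \<open>The perturbation contributes \<open>outer v a\<close> and
  \<open>outer v (K\<^sup>T *\<^sub>v l)\<close>, which add up to \<open>outer v w\<close>. The
  change of gain also has right factor \<open>w\<close>, so it alters only the left factor.\<close>

lemma closed_loop_rank_one:
  fixes A B K :: "real mat"
  assumes "A \<in> carrier_mat n n" "B \<in> carrier_mat n m" "K \<in> carrier_mat m n"
    and "a \<in> carrier_vec n" "l \<in> carrier_vec m" "v \<in> carrier_vec n"
  defines "w \<equiv> a + K\<^sup>T *\<^sub>v l"
  shows "(A + outer v a) + (B + outer v l) * (K - c \<cdot>\<^sub>m outer l w) =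
    (A + B * K) + outer (v - c \<cdot>\<^sub>v (B *\<^sub>v l) - (c * (l \<bullet> l)) \<cdot>\<^sub>v v) w"
proof -
  have w: "w \<in> carrier_vec n"
    using assms by simp
  have "(B + outer v l) * (K - c \<cdot>\<^sub>m outer l w) =
      (B + outer v l) * K - c \<cdot>\<^sub>m ((B + outer v l) * outer l w)"
    using assms(1-6) w
    by (simp add: mult_minus_distrib_mat[of _ n m _ n] mult_smult_distrib[of _ n m _ n])
  also have "(B + outer v l) * K = B * K + outer v (K\<^sup>T *\<^sub>v l)"
    using assms by (simp add: add_mult_distrib_mat[of _ n m _ _ n] outer_mult[of _ _ n])
  also have "(B + outer v l) * outer l w = outer (B *\<^sub>v l + (l \<bullet> l) \<cdot>\<^sub>v v) w"
    using assms w
    by (simp add: mult_outer[of _ n m] add_mult_distrib_mat_vec[of _ n m] outer_mult_vec)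
  finally show ?thesis
    using assms by (intro eq_matI) (auto simp: algebra_simps)
qed

text \<open>In the application \<open>a\<close> and \<open>l\<close> are corresponding rows of the
  difference of two consistent systems. All the perturbed systems are then consistent, and
  \<open>stab\<close> says that \<open>K\<close> stabilizes those that are stabilizable.\<close>

lemma stabilizing_gain_annihilates_perturbation:
  fixes A B K :: "real mat"
  assumes A: "A \<in> carrier_mat n n" and B: "B \<in> carrier_mat n m" and K: "K \<in> carrier_mat m n"
    and a: "a \<in> carrier_vec n" and l: "l \<in> carrier_vec m" "l \<noteq> 0\<^sub>v m"
    and stab: "\<And>v. v \<in> carrier_vec n \<Longrightarrow>
      (A + outer v a, B + outer v l) \<in> stabilizable_systems n m \<Longrightarrow>
      schur (A + outer v a + (B + outer v l) * K)"
    and schur: "schur (A + B * K)"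
  shows "a + K\<^sup>T *\<^sub>v l = 0\<^sub>v n"
proof (rule ccontr)
  define w where "w = a + K\<^sup>T *\<^sub>v l"
  define M where "M = A + B * K"
  define d where "d = l \<bullet> l"
  define b where "b = (1 / d) \<cdot>\<^sub>v (B *\<^sub>v l)"
  assume "a + K\<^sup>T *\<^sub>v l \<noteq> 0\<^sub>v n"
  then have w0: "w \<noteq> 0\<^sub>v n" by (simp add: w_def)
  have w: "w \<in> carrier_vec n" and M: "M \<in> carrier_mat n n" and b: "b \<in> carrier_vec n"
    using A B K a l by (auto simp: w_def M_def b_def)
  have d: "d \<noteq> 0"
    using l conjugate_square_eq_0_vec[of l m] by (simp add: d_def)
  have ww: "w \<bullet> w \<noteq> 0"
    using w w0 conjugate_square_eq_0_vec[of w n] by simp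
  \<comment> \<open>The gain \<open>K - c \<cdot>\<^sub>m outer l w\<close> only witnesses
    stabilizability; the conclusion concerns \<open>K\<close> itself, the case \<open>c = 0\<close>
    of the same formula.\<close>
  have closed_loop: "schur (M + outer v w)"
    if v: "v \<in> carrier_vec n" and *: "schur (M + outer (v - c \<cdot>\<^sub>v (B *\<^sub>v l) - (c * d) \<cdot>\<^sub>v v) w)" for v c
  proof -
    have "schur ((A + outer v a) + (B + outer v l) * (K - c \<cdot>\<^sub>m outer l w))"
      using * closed_loop_rank_one[OF A B K a l(1) v, of c] by (simp add: w_def M_def d_def)
    moreover have "K - c \<cdot>\<^sub>m outer l w \<in> carrier_mat m n"
      using l w by (intro minus_carrier_mat smult_carrier_mat outer_carrier)
    ultimately have "(A + outer v a, B + outer v l) \<in> stabilizable_systems n m"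
      using A B a l v by (auto simp: stabilizable_systems_def system_space_def)
    note stable = stab[OF v this]
    have K0: "K - 0 \<cdot>\<^sub>m outer l w = K"
      using K l w by (intro eq_matI) auto
    from stable have "schur ((A + outer v a) + (B + outer v l) * (K - 0 \<cdot>\<^sub>m outer l w))"
      unfolding K0 .
    also have "(A + outer v a) + (B + outer v l) * (K - 0 \<cdot>\<^sub>m outer l w) =
      M + outer (v - 0 \<cdot>\<^sub>v (B *\<^sub>v l) - (0 * d) \<cdot>\<^sub>v v) w"
      using closed_loop_rank_one[OF A B K a l(1) v, of 0] by (simp add: w_def M_def d_def)
    also have "v - 0 \<cdot>\<^sub>v (B *\<^sub>v l) - (0 * d) \<cdot>\<^sub>v v = v"
      using v B l by (intro eq_vecI) auto
    finally show ?thesis .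
  qed
  have "schur (M + s \<cdot>\<^sub>m outer b w)" if s: "s \<noteq> - 1" for s
  proof -
    \<comment> \<open>Since \<open>B *\<^sub>v l\<close> is \<open>d\<close> times \<open>b\<close>,
      the left factor vanishes iff s - c d - c d s = 0 (when \<open>b\<close> is nonzero); this is
      the solution, which breaks down only at s = -1.\<close>
    let ?c = "s / ((1 + s) * d)"
    have "1 + s \<noteq> 0"
      using s by simp
    then have "s \<cdot>\<^sub>v b - ?c \<cdot>\<^sub>v (B *\<^sub>v l) - (?c * d) \<cdot>\<^sub>v (s \<cdot>\<^sub>v b) = 0\<^sub>v n"
      using B l d by (intro eq_vecI) (auto simp: b_def divide_simps, auto simp: algebra_simps)
    moreover have "M + outer (0\<^sub>v n) w = M"
      using M w by (intro eq_matI) auto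
    ultimately have "schur (M + outer (s \<cdot>\<^sub>v b - ?c \<cdot>\<^sub>v (B *\<^sub>v l) - (?c * d) \<cdot>\<^sub>v (s \<cdot>\<^sub>v b)) w)"
      using schur by (simp only: M_def)
    then have "schur (M + outer (s \<cdot>\<^sub>v b) w)"
      by (rule closed_loop[rotated]) (use b in simp)
    moreover have "outer (s \<cdot>\<^sub>v b) w = s \<cdot>\<^sub>m outer b w"
      by (intro eq_matI) auto
    ultimately show ?thesis by simp
  qed
  \<comment> \<open>The missing parameter -1 is reached through closedness of the pencil.\<close>
  then have Mb: "schur (M + (- 1) \<cdot>\<^sub>m outer b w)"
    by (rule schur_pencil_closed[OF M outer_carrier[OF b w]])
  \<comment> \<open>Normalised so that \<open>w \<bullet> y = 1\<close>; then the choice of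
    \<open>v\<close> makes \<open>y\<close> a fixed vector of \<open>M + outer v w\<close>.\<close>
  define y where "y = (1 / (w \<bullet> w)) \<cdot>\<^sub>v w"
  define v where "v = y - M *\<^sub>v y"
  have y: "y \<in> carrier_vec n" and v: "v \<in> carrier_vec n"
    using w M by (auto simp: y_def v_def)
  have wy: "w \<bullet> y = 1"
    using w ww by (simp add: y_def)
  \<comment> \<open>With \<open>c = 1 / d\<close> the two terms in \<open>v\<close> cancel and only
    -b remains.\<close>
  have "outer (v - (1 / d) \<cdot>\<^sub>v (B *\<^sub>v l) - (1 / d * d) \<cdot>\<^sub>v v) w = (- 1) \<cdot>\<^sub>m outer b w"
    using v B l d by (intro eq_matI) (auto simp: b_def algebra_simps)
  then have "schur (M + outer v w)"
    using closed_loop[OF v, of "1 / d"] Mb by simp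
  moreover have "(M + outer v w) *\<^sub>v y = y"
    using M v w y wy
    by (simp add: add_mult_distrib_mat_vec[of _ n n] outer_mult_vec)
      (auto simp: v_def intro!: eq_vecI)
  moreover have "y \<noteq> 0\<^sub>v n"
    using wy w by auto
  ultimately show False
    using not_schur_if_fixed_vec[of "M + outer v w" n y] M v w y by auto
qed

section \<open>Data matrices and consistent systems\<close>

lemma col_X_minus: "t < T \<Longrightarrow> x t \<in> carrier_vec n \<Longrightarrow> col (X_minus n T x) t = x t"
  by (simp add: X_minus_def)

lemma col_U_minus: "t < T \<Longrightarrow> u t \<in> carrier_vec m \<Longrightarrow> col (U_minus m T u) t = u t"
  by (simp add: U_minus_def)

lemma col_X_plus: "t < T \<Longrightarrow> x (Suc t) \<in> carrier_vec n \<Longrightarrow> col (X_plus n T x) t = x (Suc t)"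
  \<comment> \<open>The list of samples starts at 1, hence the shift; \<open>upt_Suc\<close> would
    split off its last entry.\<close>
  by (simp add: X_plus_def del: upt_Suc)

lemma X_minus_carrier [simp, intro]: "X_minus n T x \<in> carrier_mat n T"
  by (simp add: X_minus_def mat_of_cols_def)

lemma U_minus_carrier [simp, intro]: "U_minus m T u \<in> carrier_mat m T"
  by (simp add: U_minus_def mat_of_cols_def)

lemma X_plus_carrier [simp, intro]: "X_plus n T x \<in> carrier_mat n T"
  by (intro carrier_matI) (simp_all add: X_plus_def del: upt_Suc)

lemmas dim_data [simp] =
  X_minus_carrier [THEN carrier_matD(1)] X_minus_carrier [THEN carrier_matD(2)]
  U_minus_carrier [THEN carrier_matD(1)] U_minus_carrier [THEN carrier_matD(2)]
  X_plus_carrier [THEN carrier_matD(1)] X_plus_carrier [THEN carrier_matD(2)]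

lemma true_system_consistent:
  assumes "(A, B) \<in> system_space n m" "input_state_data n m T A B u x"
  shows "(A, B) \<in> consistent_systems n m T u x"
proof -
  have A: "A \<in> carrier_mat n n" and B: "B \<in> carrier_mat n m"
    using assms by (auto simp: system_space_def)
  have "X_plus n T x = A * X_minus n T x + B * U_minus m T u"
  proof (rule mat_col_eqI)
    fix t assume "t < dim_col (A * X_minus n T x + B * U_minus m T u)"
    then have t: "t < T"
      by simp
    then have "x t \<in> carrier_vec n" "u t \<in> carrier_vec m" "x (Suc t) = A *\<^sub>v x t + B *\<^sub>v u t"
      using assms by (auto simp: input_state_data_def)
    moreover from this have "x (Suc t) \<in> carrier_vec n"
      using A B by simp
    ultimately show "col (X_plus n T x) t = col (A * X_minus n T x + B * U_minus m T u) t"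
      using t A B
      by (simp add: col_X_plus col_add[of _ n T] col_mult2[OF A X_minus_carrier]
          col_mult2[OF B U_minus_carrier] col_X_minus col_U_minus)
  qed (use A B in auto)
  then show ?thesis
    using assms by (simp add: consistent_systems_def)
qed

text \<open>The pair \<open>a\<close>, \<open>l\<close> lies in the left kernel of the stacked data
  matrix, so v (a^T X + l^T U) = 0 for every \<open>v\<close>.\<close>

lemma consistent_add_outer:
  assumes cons: "(A, B) \<in> consistent_systems n m T u x"
    and a: "a \<in> carrier_vec n" and l: "l \<in> carrier_vec m" and v: "v \<in> carrier_vec n"
    and orth: "\<And>t. t < T \<Longrightarrow> a \<bullet> col (X_minus n T x) t + l \<bullet> col (U_minus m T u) t = 0"
  shows "(A + outer v a, B + outer v l) \<in> consistent_systems n m T u x"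
proof -
  let ?X = "X_minus n T x" and ?U = "U_minus m T u"
  have A: "A \<in> carrier_mat n n" and B: "B \<in> carrier_mat n m"
    and eq: "X_plus n T x = A * ?X + B * ?U"
    using cons by (auto simp: consistent_systems_def system_space_def)
  have "(A + outer v a) * ?X + (B + outer v l) * ?U =
      (A * ?X + outer v a * ?X) + (B * ?U + outer v l * ?U)"
    using A B a l v by (simp add: add_mult_distrib_mat[OF A _ X_minus_carrier]
        add_mult_distrib_mat[OF B _ U_minus_carrier])
  also have "\<dots> = A * ?X + B * ?U"
  proof (rule eq_matI)
    fix i t assume "i < dim_row (A * ?X + B * ?U)" "t < dim_col (A * ?X + B * ?U)"
    then have it: "i < n" "t < T"
      using B by auto
    have "v $ i * (a \<bullet> col ?X t) + v $ i * (l \<bullet> col ?U t) = 0"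
      using orth[OF it(2)] by (simp flip: distrib_left)
    then show "(A * ?X + outer v a * ?X + (B * ?U + outer v l * ?U)) $$ (i, t) =
        (A * ?X + B * ?U) $$ (i, t)"
      using it A B a l v by (simp add: row_outer)
  qed (use A B v in auto)
  finally show ?thesis
    using A B a l v eq by (simp add: consistent_systems_def system_space_def)
qed

section \<open>Equivalence of the two notions of informativity\<close>

theorem theorem14:
  fixes n m T :: nat
    and A_true B_true :: "real mat"
    and u x :: "nat \<Rightarrow> real vec"
  assumes "0 < n" and "0 < m" and "0 < T"
    and "input_state_data n m T A_true B_true u x"
    and "(A_true, B_true) \<in> stabilizable_systems n m"
    and "vec_space.rank n (X_minus n T x) = n"
  shows "informative_for_stabilization_wrt (stabilizable_systems n m) n m T u x \<longleftrightarrow>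
         informative_for_stabilization n m T u x"
proof
  assume "informative_for_stabilization n m T u x"
  then show "informative_for_stabilization_wrt (stabilizable_systems n m) n m T u x"
    by (auto simp: informative_for_stabilization_def informative_for_stabilization_wrt_def
        stabilizable_systems_def)
next
  let ?X = "X_minus n T x" and ?U = "U_minus m T u"
  assume "informative_for_stabilization_wrt (stabilizable_systems n m) n m T u x"
  then obtain K where K: "K \<in> carrier_mat m n"
    and stab: "\<And>A B. (A, B) \<in> consistent_systems n m T u x \<Longrightarrow>
      (A, B) \<in> stabilizable_systems n m \<Longrightarrow> schur (A + B * K)"
    by (auto simp: informative_for_stabilization_wrt_def)
  define A B where "A = A_true" and "B = B_true"
  have AB: "(A, B) \<in> system_space n m"
    using assms(5) by (auto simp: stabilizable_systems_def A_def B_def)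
  then have A: "A \<in> carrier_mat n n" and B: "B \<in> carrier_mat n m"
    by (auto simp: system_space_def)
  have cons: "(A, B) \<in> consistent_systems n m T u x"
    using true_system_consistent[OF AB] assms(4) by (simp add: A_def B_def)
  have schur_AB: "schur (A + B * K)"
    using stab[OF cons] assms(5) by (simp add: A_def B_def)
  have "schur (A' + B' * K)" if cons': "(A', B') \<in> consistent_systems n m T u x" for A' B'
  proof -
    have A': "A' \<in> carrier_mat n n" and B': "B' \<in> carrier_mat n m"
      using cons' by (auto simp: consistent_systems_def system_space_def)
    have eq: "A' * ?X + B' * ?U = A * ?X + B * ?U"
      using cons cons' by (auto simp: consistent_systems_def)
    \<comment> \<open>This vector is the i-th row of the difference of the two closed loops under
      \<open>K\<close>.\<close>
    have rows: "row (A' - A) i + K\<^sup>T *\<^sub>v row (B' - B) i = 0\<^sub>v n" if i: "i < n" for i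
    proof -
      define a where "a = row (A' - A) i"
      define l where "l = row (B' - B) i"
      have a: "a \<in> carrier_vec n" and l: "l \<in> carrier_vec m"
        using A B by (auto simp: a_def l_def intro!: carrier_vecI)
      \<comment> \<open>Entry (i, t) of the difference of the two data equations.\<close>
      have orth: "a \<bullet> col ?X t + l \<bullet> col ?U t = 0" if t: "t < T" for t
      proof -
        have cols: "col ?X t \<in> carrier_vec n" "col ?U t \<in> carrier_vec m"
          using t by (auto intro!: carrier_vecI)
        have "a = row A' i - row A i" "l = row B' i - row B i"
          using A A' B B' i by (auto simp: a_def l_def)
        then have "a \<bullet> col ?X t + l \<bullet> col ?U t =
            (A' * ?X + B' * ?U) $$ (i, t) - (A * ?X + B * ?U) $$ (i, t)"
          using A A' B B' i t cols
          by (simp add: minus_scalar_prod_distrib[of _ n] minus_scalar_prod_distrib[of _ m])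
        then show ?thesis
          by (simp add: eq)
      qed
      show ?thesis
      \<comment> \<open>The perturbation argument divides by \<open>l \<bullet> l\<close>. If
        \<open>l\<close> vanishes, \<open>a\<close> is orthogonal to all state samples, and full row
        rank forces it to vanish too.\<close>
      proof (cases "l = 0\<^sub>v m")
        case True
        have "a \<bullet> col ?X t = 0" if "t < T" for t
          using orth[OF that] True that by simp
        then have "a = 0\<^sub>v n"
          by (rule row_scalar_prods_zero_imp_zero[OF X_minus_carrier assms(6) a])
        then show ?thesis
          using K True unfolding a_def[symmetric] l_def[symmetric]
          by (intro eq_vecI) auto
      next
        case False
        have "a + K\<^sup>T *\<^sub>v l = 0\<^sub>v n"
          by (rule stabilizing_gain_annihilates_perturbation[OF A B K a l False _ schur_AB])
            (rule stab[OF consistent_add_outer[OF cons a l _ orth]])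
        then show ?thesis
          by (simp add: a_def l_def)
      qed
    qed
    have "A' + B' * K = A + B * K"
    proof (rule eq_matI)
      fix i j assume "i < dim_row (A + B * K)" "j < dim_col (A + B * K)"
      then have ij: "i < n" "j < n"
        using B K by auto
      have "row (B' - B) i = row B' i - row B i"
        using B B' ij by auto
      \<comment> \<open>Entry \<open>j\<close> of \<open>rows\<close>, with the product by the
        transpose of \<open>K\<close> read as a scalar product with a column of
        \<open>K\<close>.\<close>
      then have "A' $$ (i, j) - A $$ (i, j) + (row B' i - row B i) \<bullet> col K j = 0"
        using arg_cong[OF rows[OF ij(1)], of "\<lambda>v. v $ j"] A A' B B' K ij
        by (simp add: comm_scalar_prod[of "col K j" m])
      then show "(A' + B' * K) $$ (i, j) = (A + B * K) $$ (i, j)"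
        using A A' B B' K ij by (simp add: minus_scalar_prod_distrib[of _ m])
    qed (use B B' K in auto)
    then show ?thesis
      using schur_AB by simp
  qed
  then show "informative_for_stabilization n m T u x"
    using K by (auto simp: informative_for_stabilization_def informative_for_stabilization_wrt_def)
qed

end
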